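(* Let $F_{\infty}$ be the free group on the countably infinite set of free generators $\{x_i : i \in \mathbb{Z}\}$, and let $\varphi : F_{\infty} \to F_{\infty}$ be the shifting automorphism, $\varphi(x_i) = x_{i-1}$ for all $i \in \mathbb{Z}$. Let $F_{\infty}(\varphi) = F_{\infty} \rtimes \langle t \rangle$ be the split extension of $F_\infty$ by the infinite cyclic group $\langle t \rangle$ in which conjugation by $t$ induces $\varphi$, i.e. $t^{-1} x_i t = x_{i-1}$ for all $i \in \mathbb{Z}$. Then the conjugacy problem is solvable for $F_{\infty}(\varphi)$.
   Context: Every element of $F_{\infty}(\varphi)$ can be written uniquely as $t^m V$ with $m \in \mathbb{Z}$ and $V$ a reduced word in the letters $x_i^{\pm 1}$, $i \in \mathbb{Z}$. The conjugacy problem for the group is solvable if there is an algorithm which, given two words in the generators $t$, $x_i$ ($i \in \mathbb{Z}$) and their inverses, decides whether the elements they represent are conjugate in the group. *)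

theory Defs
  imports "HOL-Algebra.Bij" "HOL-Library.Nat_Bijection"
begin

section \<open>Free groups\<close>

text \<open>A letter \<open>(x, True)\<close> stands for \<open>x\<close> and \<open>(x, False)\<close> for the inverse of \<open>x\<close>.\<close>

type_synonym 'a gword = "('a \<times> bool) list"

fun inv_letter :: "'a \<times> bool \<Rightarrow> 'a \<times> bool" where
  "inv_letter (x, e) = (x, \<not> e)"

fun reduced :: "'a gword \<Rightarrow> bool" where
  "reduced [] \<longleftrightarrow> True"
| "reduced [a] \<longleftrightarrow> True"
| "reduced (a # b # w) \<longleftrightarrow> b \<noteq> inv_letter a \<and> reduced (b # w)"

text \<open>For reduced \<open>w\<close>, \<open>letter_mult a w\<close> is the reduced form of \<open>a # w\<close>.\<close>

fun letter_mult :: "'a \<times> bool \<Rightarrow> 'a gword \<Rightarrow> 'a gword" where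
  "letter_mult a [] = [a]"
| "letter_mult a (b # w) = (if b = inv_letter a then w else a # b # w)"

definition free_group :: "'a gword monoid" where
  "free_group = \<lparr>carrier = {w. reduced w}, mult = \<lambda>u v. foldr letter_mult u v, one = []\<rparr>"

lemma inv_letter_inv_letter [simp]: "inv_letter (inv_letter a) = a"
  by (cases a) simp

lemma reduced_tl: "reduced (a # w) \<Longrightarrow> reduced w"
  by (cases w) auto

lemma reduced_letter_mult: "reduced w \<Longrightarrow> reduced (letter_mult a w)"
  by (cases w) (auto dest: reduced_tl)

lemma reduced_foldr: "reduced v \<Longrightarrow> reduced (foldr letter_mult u v)"
  by (induction u) (auto intro: reduced_letter_mult)

lemma letter_mult_inv_left:
  assumes "reduced w"
  shows "letter_mult a (letter_mult (inv_letter a) w) = w"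
  using assms by (cases w rule: reduced.cases) auto

lemma letter_mult_inv_right:
  assumes "reduced w"
  shows "letter_mult (inv_letter a) (letter_mult a w) = w"
  using letter_mult_inv_left [OF assms, of "inv_letter a"] by simp

lemma foldr_letter_mult:
  assumes "reduced w"
  shows "foldr letter_mult (letter_mult a u) w = letter_mult a (foldr letter_mult u w)"
  using assms by (cases u) (auto simp: letter_mult_inv_left reduced_foldr)

lemma foldr_assoc:
  assumes "reduced w"
  shows "foldr letter_mult (foldr letter_mult u v) w = foldr letter_mult u (foldr letter_mult v w)"
  by (induction u) (auto simp: foldr_letter_mult assms)

lemma foldr_reduced: "reduced u \<Longrightarrow> foldr letter_mult u [] = u"
proof (induction u)
  case (Cons a u)
  then show ?case by (cases u) auto
qed simp

lemma foldr_inv_word: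
  assumes "reduced w"
  shows "foldr letter_mult (rev (map inv_letter u)) (foldr letter_mult u w) = w"
  using assms
proof (induction u arbitrary: w)
  case (Cons a u)
  then show ?case by (simp add: letter_mult_inv_right reduced_foldr)
qed simp

lemma group_free_group: "group (free_group :: 'a gword monoid)"
proof (rule groupI)
  fix x :: "'a gword"
  assume x: "x \<in> carrier free_group"
  let ?y = "foldr letter_mult (rev (map inv_letter x)) []"
  have "?y \<in> carrier free_group"
    by (simp add: free_group_def reduced_foldr)
  moreover have "?y \<otimes>\<^bsub>free_group\<^esub> x = \<one>\<^bsub>free_group\<^esub>"
    using x foldr_inv_word [of "[]" x]
    by (simp add: free_group_def foldr_assoc foldr_reduced)
  ultimately show "\<exists>y\<in>carrier free_group. y \<otimes>\<^bsub>free_group\<^esub> x = \<one>\<^bsub>free_group\<^esub>" by blast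
qed (auto simp: free_group_def foldr_assoc reduced_foldr foldr_reduced)


section \<open>Values of words in the generators of a group\<close>

text \<open>The word need not be reduced; \<open>gen\<close> interprets the generator symbols in \<open>G\<close>.\<close>

definition letter_value :: "('g, 'b) monoid_scheme \<Rightarrow> ('a \<Rightarrow> 'g) \<Rightarrow> 'a \<times> bool \<Rightarrow> 'g" where
  "letter_value G gen = (\<lambda>(x, e). if e then gen x else inv\<^bsub>G\<^esub> gen x)"

definition word_value :: "('g, 'b) monoid_scheme \<Rightarrow> ('a \<Rightarrow> 'g) \<Rightarrow> 'a gword \<Rightarrow> 'g" where
  "word_value G gen w = foldr (\<lambda>a g. letter_value G gen a \<otimes>\<^bsub>G\<^esub> g) w \<one>\<^bsub>G\<^esub>"

text \<open>The universal property of \<open>free_group\<close>, existence part.\<close>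

lemma word_value_hom:
  assumes "group G" and f: "\<And>x. f x \<in> carrier G"
  shows "word_value G f \<in> hom free_group G" and "word_value G f [(x, True)] = f x"
proof -
  interpret group G by fact
  have lv: "letter_value G f a \<in> carrier G" for a
    using f by (auto simp: letter_value_def split: prod.split)
  have lv_inv: "letter_value G f (inv_letter a) = inv\<^bsub>G\<^esub> letter_value G f a" for a
    using f by (cases a) (auto simp: letter_value_def)
  have closed: "word_value G f w \<in> carrier G" for w
    by (induction w) (auto simp: word_value_def lv)
  have Cons: "word_value G f (a # w) = letter_value G f a \<otimes>\<^bsub>G\<^esub> word_value G f w" for a w
    by (simp add: word_value_def)
  have step: "word_value G f (letter_mult a w) = letter_value G f a \<otimes>\<^bsub>G\<^esub> word_value G f w" for a w
    by (cases w) (auto simp: Cons closed lv lv_inv m_assoc [symmetric])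
  have "word_value G f (foldr letter_mult u v) = word_value G f u \<otimes>\<^bsub>G\<^esub> word_value G f v" for u v
  proof (induction u)
    case Nil
    then show ?case using closed [of v] by (simp add: word_value_def)
  next
    case (Cons a u)
    then show ?case by (simp add: step \<open>\<And>a w. word_value G f (a # w) = _\<close> m_assoc lv closed)
  qed
  then show "word_value G f \<in> hom free_group G"
    by (auto simp: hom_def free_group_def closed)
  show "word_value G f [(x, True)] = f x"
    using f by (simp add: word_value_def letter_value_def)
qed


section \<open>Split extensions by an infinite cyclic group\<close>

text \<open>
  The pair \<open>(m, V)\<close> represents \<open>t\<^sup>m V\<close>. As conjugation by \<open>t\<close> induces \<open>\<phi>\<close>, i.e.
  \<open>t\<^sup>-\<^sup>1 V t = \<phi> V\<close>, we have \<open>V t\<^sup>n = t\<^sup>n (\<phi>\<^sup>n V)\<close>, whence the multiplication below.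
  The integer power is taken in the automorphism group, so \<open>\<phi>\<close> has to be an element
  of \<open>auto G\<close> and in particular extensional on \<open>carrier G\<close>.
\<close>

definition cyclic_extension :: "'g monoid \<Rightarrow> ('g \<Rightarrow> 'g) \<Rightarrow> (int \<times> 'g) monoid" where
  "cyclic_extension G \<phi> =
    \<lparr>carrier = UNIV \<times> carrier G,
     mult = \<lambda>(m, V) (n, W). (m + n, (\<phi> [^]\<^bsub>AutoGroup G\<^esub> n) V \<otimes>\<^bsub>G\<^esub> W),
     one = (0, \<one>\<^bsub>G\<^esub>)\<rparr>"

lemma group_cyclic_extension:
  assumes "group G" and phi: "\<phi> \<in> auto G"
  shows "group (cyclic_extension G \<phi>)"
proof -
  interpret G: group G by fact
  interpret A: group "AutoGroup G" by (rule G.AutoGroup)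
  let ?p = "\<lambda>n::int. \<phi> [^]\<^bsub>AutoGroup G\<^esub> n"
  have phiA: "\<phi> \<in> carrier (AutoGroup G)" using phi by (simp add: AutoGroup_def)
  have pA: "?p n \<in> auto G" for n
    using A.int_pow_closed [OF phiA, of n] by (simp add: AutoGroup_def)
  have pc: "?p n x \<in> carrier G" if "x \<in> carrier G" for n x
    using pA [of n] that by (auto simp: auto_def hom_def)
  have pm: "?p n (x \<otimes>\<^bsub>G\<^esub> y) = ?p n x \<otimes>\<^bsub>G\<^esub> ?p n y" if "x \<in> carrier G" "y \<in> carrier G" for n x y
    using pA [of n] that by (auto simp: auto_def hom_def)
  have p0: "?p 0 x = x" if "x \<in> carrier G" for x
    using that by (simp add: AutoGroup_def BijGroup_def)
  have padd: "?p (m + n) x = ?p m (?p n x)" if "x \<in> carrier G" for m n x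
  proof -
    have "?p (m + n) = ?p m \<otimes>\<^bsub>AutoGroup G\<^esub> ?p n" by (rule A.int_pow_mult [OF phiA])
    then show ?thesis
      using pA [of m] pA [of n] that
      by (simp add: AutoGroup_def BijGroup_def auto_def compose_def)
  qed
  have p1: "?p n \<one>\<^bsub>G\<^esub> = \<one>\<^bsub>G\<^esub>" for n
    using pm [of "\<one>\<^bsub>G\<^esub>" "\<one>\<^bsub>G\<^esub>" n] pc [of "\<one>\<^bsub>G\<^esub>" n] G.l_cancel_one' by auto
  show ?thesis
  proof (rule groupI)
    fix x assume x: "x \<in> carrier (cyclic_extension G \<phi>)"
    obtain m V where xV: "x = (m, V)" "V \<in> carrier G"
      using x by (cases x) (auto simp: cyclic_extension_def)
    define y where "y = (- m, ?p (- m) (inv\<^bsub>G\<^esub> V))"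
    have "?p m (?p (- m) (inv\<^bsub>G\<^esub> V)) = inv\<^bsub>G\<^esub> V"
      using padd [of "inv\<^bsub>G\<^esub> V" m "- m"] p0 xV by simp
    then have "y \<otimes>\<^bsub>cyclic_extension G \<phi>\<^esub> x = \<one>\<^bsub>cyclic_extension G \<phi>\<^esub>"
      using xV by (simp add: y_def cyclic_extension_def)
    moreover have "y \<in> carrier (cyclic_extension G \<phi>)"
      using xV by (simp add: y_def cyclic_extension_def pc)
    ultimately show "\<exists>y\<in>carrier (cyclic_extension G \<phi>).
        y \<otimes>\<^bsub>cyclic_extension G \<phi>\<^esub> x = \<one>\<^bsub>cyclic_extension G \<phi>\<^esub>" by blast
  next
    fix x y z
    assume "x \<in> carrier (cyclic_extension G \<phi>)" "y \<in> carrier (cyclic_extension G \<phi>)"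
      "z \<in> carrier (cyclic_extension G \<phi>)"
    then show "x \<otimes>\<^bsub>cyclic_extension G \<phi>\<^esub> y \<otimes>\<^bsub>cyclic_extension G \<phi>\<^esub> z =
        x \<otimes>\<^bsub>cyclic_extension G \<phi>\<^esub> (y \<otimes>\<^bsub>cyclic_extension G \<phi>\<^esub> z)"
      by (cases x; cases y; cases z)
        (simp add: cyclic_extension_def pm pc G.m_assoc padd [symmetric] add.commute)
  qed (auto simp: cyclic_extension_def pc p0 p1)
qed


section \<open>The group \<open>F\<^sub>\<infinity>(\<phi>)\<close>\<close>

definition F_inf :: "int gword monoid" where
  "F_inf = free_group"

definition shift :: "int gword \<Rightarrow> int gword" where
  "shift = restrict (map (\<lambda>(i, e). (i - 1, e))) (carrier F_inf)"

definition F_inf_ext :: "(int \<times> int gword) monoid" where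
  "F_inf_ext = cyclic_extension F_inf shift"

datatype gen = Gen_t | Gen_x int

fun gen_value :: "gen \<Rightarrow> int \<times> int gword" where
  "gen_value Gen_t = (1, [])"
| "gen_value (Gen_x i) = (0, [(i, True)])"

lemma shift_gen: "shift [(i, True)] = [(i - 1, True)]"
  by (simp add: shift_def F_inf_def free_group_def)

lemma shift_auto: "shift \<in> auto F_inf"
proof -
  let ?s = "\<lambda>k::int. map (\<lambda>(i::int, e::bool). (i + k, e))"
  have red: "reduced (?s k w) = reduced w" for k w
    by (induction w rule: reduced.induct) auto
  have lm: "?s k (letter_mult a w) = letter_mult ((\<lambda>(i, e). (i + k, e)) a) (?s k w)" for k a w
    by (cases w; cases a) auto
  have fm: "?s k (foldr letter_mult u v) = foldr letter_mult (?s k u) (?s k v)" for k u v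
    by (induction u) (auto simp: lm)
  have sh: "shift = restrict (?s (- 1)) (carrier F_inf)"
    by (simp add: shift_def)
  have inv: "?s k (?s (- k) w) = w" for k w
    by (induction w) auto
  have "bij_betw shift (carrier F_inf) (carrier F_inf)"
    by (rule bij_betw_byWitness [where f' = "?s 1"])
      (use inv [of 1] inv [of "- 1"] red [of 1] red [of "- 1"] in
        \<open>auto simp: sh F_inf_def free_group_def simp del: map_map\<close>)
  moreover have "shift \<in> hom F_inf F_inf"
    using red [of "- 1"] fm [of "- 1"]
    by (intro homI) (auto simp: sh F_inf_def free_group_def reduced_foldr simp del: map_map)
  ultimately show ?thesis
    by (simp add: auto_def Bij_def shift_def)
qed

lemma group_F_inf_ext: "group F_inf_ext"
  unfolding F_inf_ext_def
  by (rule group_cyclic_extension [OF _ shift_auto]) (simp add: F_inf_def group_free_group)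

lemma gen_value_carrier: "gen_value g \<in> carrier F_inf_ext"
  by (cases g) (simp_all add: F_inf_ext_def cyclic_extension_def F_inf_def free_group_def)

lemma t_conj_x:
  "inv\<^bsub>F_inf_ext\<^esub> gen_value Gen_t \<otimes>\<^bsub>F_inf_ext\<^esub> gen_value (Gen_x i) \<otimes>\<^bsub>F_inf_ext\<^esub> gen_value Gen_t
    = gen_value (Gen_x (i - 1))"
proof -
  interpret E: group F_inf_ext by (rule group_F_inf_ext)
  interpret A: group "AutoGroup F_inf"
    by (rule group.AutoGroup) (simp add: F_inf_def group_free_group)
  have sA: "shift \<in> carrier (AutoGroup F_inf)" using shift_auto by (simp add: AutoGroup_def)
  have "gen_value (Gen_x i) \<otimes>\<^bsub>F_inf_ext\<^esub> gen_value Gen_t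
      = gen_value Gen_t \<otimes>\<^bsub>F_inf_ext\<^esub> gen_value (Gen_x (i - 1))"
    by (simp add: F_inf_ext_def cyclic_extension_def A.int_pow_1 [OF sA] shift_gen)
      (simp add: F_inf_def free_group_def AutoGroup_def BijGroup_def)
  then show ?thesis
    using gen_value_carrier
    by (metis E.m_assoc E.inv_closed E.l_inv E.l_one)
qed


section \<open>Recursive functions\<close>

text \<open>
  The general recursive functions of \<open>n\<close> arguments, given as functions on argument lists of length \<open>n\<close>:
  the least class with the initial functions that is closed under composition,
  primitive recursion (on the first argument) and minimization of regular functions.
  As minimization is restricted to regular functions, these are precisely the total computable
  functions. Values on lists whose length is not \<open>n\<close> are irrelevant.
\<close>

inductive recursive_fun :: "nat \<Rightarrow> (nat list \<Rightarrow> nat) \<Rightarrow> bool" where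
  rec_zero: "recursive_fun n (\<lambda>xs. 0)"
| rec_succ: "recursive_fun 1 (\<lambda>xs. Suc (xs ! 0))"
| rec_proj: "i < n \<Longrightarrow> recursive_fun n (\<lambda>xs. xs ! i)"
| rec_comp: "recursive_fun (length gs) f \<Longrightarrow> \<forall>g \<in> set gs. recursive_fun n g \<Longrightarrow>
    recursive_fun n (\<lambda>xs. f (map (\<lambda>g. g xs) gs))"
| rec_prim: "recursive_fun n f \<Longrightarrow> recursive_fun (Suc (Suc n)) g \<Longrightarrow>
    recursive_fun (Suc n) (\<lambda>xs. rec_nat (f (tl xs)) (\<lambda>k r. g (k # r # tl xs)) (hd xs))"
| rec_min: "recursive_fun (Suc n) f \<Longrightarrow> \<forall>xs. length xs = n \<longrightarrow> (\<exists>y. f (y # xs) = 0) \<Longrightarrow>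
    recursive_fun n (\<lambda>xs. LEAST y. f (y # xs) = 0)"

definition decidable_rel :: "(nat \<Rightarrow> nat \<Rightarrow> bool) \<Rightarrow> bool" where
  "decidable_rel R \<longleftrightarrow>
    (\<exists>f. recursive_fun 2 f \<and> (\<forall>m n. f [m, n] = (if R m n then 1 else 0)))"


section \<open>The conjugacy problem\<close>

definition conjugate_in :: "('g, 'b) monoid_scheme \<Rightarrow> 'g \<Rightarrow> 'g \<Rightarrow> bool" where
  "conjugate_in G a b \<longleftrightarrow> (\<exists>g \<in> carrier G. inv\<^bsub>G\<^esub> g \<otimes>\<^bsub>G\<^esub> a \<otimes>\<^bsub>G\<^esub> g = b)"

text \<open>
  Words are presented to the algorithm by their Goedel numbers, relative to a
  numbering \<open>code\<close> of the generator symbols. If \<open>code\<close> is a bijection onto the natural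
  numbers, then so is \<open>word_code code\<close>, so every number is the code of exactly one word.
\<close>

definition letter_code :: "('a \<Rightarrow> nat) \<Rightarrow> 'a \<times> bool \<Rightarrow> nat" where
  "letter_code code = (\<lambda>(x, e). sum_encode (if e then Inl (code x) else Inr (code x)))"

definition word_code :: "('a \<Rightarrow> nat) \<Rightarrow> 'a gword \<Rightarrow> nat" where
  "word_code code w = list_encode (map (letter_code code) w)"

definition conjugacy_problem_solvable ::
    "('g, 'b) monoid_scheme \<Rightarrow> ('a \<Rightarrow> 'g) \<Rightarrow> ('a \<Rightarrow> nat) \<Rightarrow> bool" where
  "conjugacy_problem_solvable G gen code \<longleftrightarrow>
    decidable_rel (\<lambda>m n. \<exists>u v. word_code code u = m \<and> word_code code v = n \<and>
      conjugate_in G (word_value G gen u) (word_value G gen v))"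

fun gen_code :: "gen \<Rightarrow> nat" where
  "gen_code Gen_t = 0"
| "gen_code (Gen_x i) = Suc (int_encode i)"

lemma bij_gen_code: "bij gen_code"
proof (rule bijI)
  show "inj gen_code"
  proof (rule injI)
    fix a b assume "gen_code a = gen_code b"
    then show "a = b" by (cases a; cases b) (auto simp: int_encode_eq)
  qed
  show "surj gen_code"
  proof (rule surjI)
    fix n
    show "gen_code (case n of 0 \<Rightarrow> Gen_t | Suc k \<Rightarrow> Gen_x (int_decode k)) = n"
      by (cases n) auto
  qed
qed

lemma bij_word_code:
  assumes "bij code"
  shows "bij (word_code code)"
proof -
  have inj: "inj (letter_code code)"
    using assms by (auto intro!: injI simp: letter_code_def bij_def inj_eq sum_encode_eq split: if_splits)
  have "surj (letter_code code)"
  proof (rule surjI)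
    fix n
    show "letter_code code
        (case sum_decode n of Inl k \<Rightarrow> (inv_into UNIV code k, True) | Inr k \<Rightarrow> (inv_into UNIV code k, False)) = n"
      using assms sum_decode_inverse [of n]
      by (auto simp: letter_code_def bij_def surj_f_inv_f split: sum.split simp del: sum_decode_inverse)
  qed
  then have "bij (map (letter_code code))"
    using inj lists_image [of "letter_code code" UNIV] by (simp add: bij_def)
  then have "bij (list_encode \<circ> map (letter_code code))"
    by (rule bij_comp) (rule bij_list_encode)
  then show ?thesis by (simp add: word_code_def [abs_def] comp_def)
qed

end

theory Submission
  imports Defs
begin

text \<open>
  As \<open>x\<^sub>i = t\<^sup>i x\<^sub>0 t\<^sup>-\<^sup>i\<close>, the group \<open>F\<^sub>\<infinity>(\<phi>)\<close> is free on \<open>t\<close> and \<open>x\<^sub>0\<close>. In a free group,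
  two cyclically reduced words are conjugate only if one is a rotation of the other, so
  conjugate reduced words \<open>U\<close>, \<open>V\<close> have a conjugator that can be written with at most
  \<open>length U + length V\<close> letters. This bounds the Goedel number of a conjugator, and conjugacy
  is decided by a bounded search for \<open>g\<close> with \<open>U g = g V\<close>.
\<close>


section \<open>Closure properties of recursive functions\<close>

text \<open>A bound on the length of a conjugator bounds its code only over a finite alphabet,
  whereas the given generators include all the x_i; this is why the search is justified in rank two.
  There x_i becomes a word of length 2|i| + 1, so the bound is taken from the reduced forms in rank
  two and not from the input words. The candidates are codes of words in t and the x_i, every number
  being such a code; as t, x_0 and their inverses have the same letter codes in both alphabets, a
  short conjugator in rank two is itself a candidate. Comparing U g with g V leaves one operation to
  be made recursive: left multiplication of a reduced word by a coded word. Values of recursive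
  functions on lists of the wrong length are irrelevant, so closure properties are stated for
  \<open>computable\<close>, which compares values on lists of length \<open>n\<close> only.\<close>

definition computable :: "nat \<Rightarrow> (nat list \<Rightarrow> nat) \<Rightarrow> bool" where
  "computable n h \<longleftrightarrow> (\<exists>f. recursive_fun n f \<and> (\<forall>xs. length xs = n \<longrightarrow> f xs = h xs))"

lemma computable_proj: "i < n \<Longrightarrow> computable n (\<lambda>xs. xs ! i)"
  unfolding computable_def by (blast intro: rec_proj)

lemma computable_comp:
  assumes h: "computable (length gs) h" and gs: "\<And>g. g \<in> set gs \<Longrightarrow> computable n g"
  shows "computable n (\<lambda>xs. h (map (\<lambda>g. g xs) gs))"
proof -
  obtain f where f: "recursive_fun (length gs) f" "\<And>xs. length xs = length gs \<Longrightarrow> f xs = h xs"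
    using h unfolding computable_def by blast
  have "\<forall>g\<in>set gs. \<exists>g'. recursive_fun n g' \<and> (\<forall>xs. length xs = n \<longrightarrow> g' xs = g xs)"
    using gs unfolding computable_def by blast
  then obtain r where r: "\<forall>g\<in>set gs. recursive_fun n (r g) \<and> (\<forall>xs. length xs = n \<longrightarrow> r g xs = g xs)"
    by metis
  have "recursive_fun n (\<lambda>xs. f (map (\<lambda>g. g xs) (map r gs)))"
    using f(1) r by (intro rec_comp) auto
  moreover have "f (map (\<lambda>g. g xs) (map r gs)) = h (map (\<lambda>g. g xs) gs)" if "length xs = n" for xs
  proof -
    have "map (\<lambda>g. g xs) (map r gs) = map (\<lambda>g. g xs) gs" using r that by simp
    then show ?thesis using f(2) [of "map (\<lambda>g. g xs) gs"] by (metis length_map)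
  qed
  ultimately show ?thesis unfolding computable_def by blast
qed

text \<open>Curried forms for a fixed number of arguments: an operation treated once on its bare
  arguments can then be applied to arbitrary computable subterms, the shape shared by the rules in
  \<open>computable_intros\<close>.\<close>

lemma computable_comp1:
  assumes "computable 1 (\<lambda>xs. F (xs ! 0))" "computable n g"
  shows "computable n (\<lambda>xs. F (g xs))"
  using computable_comp [of "[g]" "\<lambda>xs. F (xs ! 0)" n] assms by simp

lemma computable_comp2:
  assumes "computable 2 (\<lambda>xs. F (xs ! 0) (xs ! 1))" "computable n g" "computable n h"
  shows "computable n (\<lambda>xs. F (g xs) (h xs))"
  using computable_comp [of "[g, h]" "\<lambda>xs. F (xs ! 0) (xs ! 1)" n] assms
  by (auto simp: numeral_2_eq_2)

lemma computable_comp3: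
  assumes "computable 3 (\<lambda>xs. F (xs ! 0) (xs ! 1) (xs ! 2))"
    "computable n g" "computable n h" "computable n k"
  shows "computable n (\<lambda>xs. F (g xs) (h xs) (k xs))"
  using computable_comp [of "[g, h, k]" "\<lambda>xs. F (xs ! 0) (xs ! 1) (xs ! 2)" n] assms
  by (auto simp: numeral_3_eq_3)

lemma computable_rec:
  assumes "computable n f" "computable (Suc (Suc n)) g"
  shows "computable (Suc n) (\<lambda>xs. rec_nat (f (tl xs)) (\<lambda>k r. g (k # r # tl xs)) (hd xs))"
proof -
  obtain f' where f': "recursive_fun n f'" "\<And>xs. length xs = n \<Longrightarrow> f' xs = f xs"
    using assms(1) unfolding computable_def by blast
  obtain g' where g': "recursive_fun (Suc (Suc n)) g'" "\<And>xs. length xs = Suc (Suc n) \<Longrightarrow> g' xs = g xs"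
    using assms(2) unfolding computable_def by blast
  show ?thesis
    unfolding computable_def
    by (rule exI, rule conjI, rule rec_prim [OF f'(1) g'(1)]) (simp add: f'(2) g'(2))
qed

lemma computable_cong:
  assumes "computable n f" "\<And>xs. length xs = n \<Longrightarrow> f xs = g xs"
  shows "computable n g"
  using assms unfolding computable_def by auto

lemma computable_rec1:
  assumes "computable 1 (\<lambda>xs. f (xs ! 0))" "computable 3 (\<lambda>xs. g (xs ! 0) (xs ! 1) (xs ! 2))"
  shows "computable 2 (\<lambda>xs. rec_nat (f (xs ! 1)) (\<lambda>k r. g k r (xs ! 1)) (xs ! 0))"
  using computable_rec [OF assms(1), of "\<lambda>xs. g (xs ! 0) (xs ! 1) (xs ! 2)"] assms(2)
  by (auto simp: numeral_2_eq_2 numeral_3_eq_3 length_Suc_conv elim!: computable_cong)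

lemma computable_rec2:
  assumes "computable 2 (\<lambda>xs. f (xs ! 0) (xs ! 1))"
    "computable 4 (\<lambda>xs. g (xs ! 0) (xs ! 1) (xs ! 2) (xs ! 3))"
  shows "computable 3 (\<lambda>xs. rec_nat (f (xs ! 1) (xs ! 2)) (\<lambda>k r. g k r (xs ! 1) (xs ! 2)) (xs ! 0))"
  using computable_rec [OF assms(1), of "\<lambda>xs. g (xs ! 0) (xs ! 1) (xs ! 2) (xs ! 3)"] assms(2)
  by (auto simp: eval_nat_numeral length_Suc_conv elim!: computable_cong)

text \<open>The single appeal to minimization, made to find the diagonal of the pairing function;
  \<open>ex\<close> is the regularity that \<open>rec_min\<close> demands.\<close>

lemma computable_least:
  assumes "computable 2 (\<lambda>xs. f (xs ! 0) (xs ! 1))" and ex: "\<And>x. \<exists>y. f y x = 0"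
  shows "computable 1 (\<lambda>xs. LEAST y. f y (xs ! 0) = 0)"
proof -
  obtain f' where f': "recursive_fun 2 f'" "\<And>xs. length xs = 2 \<Longrightarrow> f' xs = f (xs ! 0) (xs ! 1)"
    using assms(1) unfolding computable_def by blast
  have "recursive_fun 1 (\<lambda>xs. LEAST y. f' (y # xs) = 0)"
    using f' ex by (intro rec_min) (auto simp: numeral_2_eq_2)
  moreover have "(LEAST y. f' (y # xs) = 0) = (LEAST y. f y (xs ! 0) = 0)" if "length xs = 1" for xs
    using f'(2) that by simp
  ultimately show ?thesis unfolding computable_def by blast
qed

section \<open>Elementary arithmetic and case distinctions\<close>

named_theorems computable_intros

declare computable_proj [computable_intros]

lemma computable_Suc [computable_intros]:
  assumes "computable n f"
  shows "computable n (\<lambda>xs. Suc (f xs))"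
proof (rule computable_comp1 [OF _ assms])
  show "computable 1 (\<lambda>xs. Suc (xs ! 0))"
    unfolding computable_def using rec_succ by blast
qed

lemma computable_const [computable_intros]: "computable n (\<lambda>xs. c)"
proof (induction c)
  case 0
  show ?case unfolding computable_def using rec_zero by blast
qed (rule computable_Suc)

lemma computable_if_zero [computable_intros]:
  assumes "computable n f" "computable n g" "computable n h"
  shows "computable n (\<lambda>xs. if f xs = 0 then g xs else h xs)"
proof (rule computable_comp3 [OF _ assms])
  have "computable 3 (\<lambda>xs. rec_nat (xs ! 1) (\<lambda>_ _. xs ! 2) (xs ! 0))"
    by (rule computable_rec2) (intro computable_intros; simp)+
  moreover have "rec_nat (xs ! 1) (\<lambda>_ _. xs ! 2) (xs ! 0) = (if xs ! 0 = 0 then xs ! 1 else xs ! 2)"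
    for xs :: "nat list"
    by (cases "xs ! 0") auto
  ultimately show "computable 3 (\<lambda>xs. if xs ! 0 = 0 then xs ! 1 else xs ! 2)"
    by simp
qed

lemma computable_add [computable_intros]:
  assumes "computable n f" "computable n g"
  shows "computable n (\<lambda>xs. f xs + g xs)"
proof (rule computable_comp2 [OF _ assms])
  have "computable 2 (\<lambda>xs. rec_nat (xs ! 1) (\<lambda>_ r. Suc r) (xs ! 0))"
    by (rule computable_rec1) (intro computable_intros; simp)+
  moreover have "rec_nat b (\<lambda>_ r. Suc r) a = a + b" for a b
    by (induction a) auto
  ultimately show "computable 2 (\<lambda>xs. xs ! 0 + xs ! 1)"
    by simp
qed

lemma computable_pred [computable_intros]:
  assumes "computable n f"
  shows "computable n (\<lambda>xs. f xs - 1)"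
\<comment> \<open>The recursion scheme carries a parameter; a unary function is obtained by feeding
  it the constant 0.\<close>
proof (rule computable_comp2 [OF _ assms computable_const [of n 0]])
  have "computable 2 (\<lambda>xs. rec_nat 0 (\<lambda>k _. k) (xs ! 0))"
    by (rule computable_rec1) (intro computable_intros; simp)+
  moreover have "rec_nat 0 (\<lambda>k _. k) a = a - 1" for a :: nat
    by (cases a) auto
  ultimately show "computable 2 (\<lambda>xs. xs ! 0 - 1)"
    by simp
qed

lemma computable_diff [computable_intros]:
  assumes "computable n f" "computable n g"
  shows "computable n (\<lambda>xs. f xs - g xs)"
\<comment> \<open>Truncated subtraction iterates the predecessor, so the recursion runs on the
  subtrahend and the arguments are swapped.\<close>
proof (rule computable_comp2 [OF _ assms(2,1)])
  have "computable 2 (\<lambda>xs. rec_nat (xs ! 1) (\<lambda>_ r. r - 1) (xs ! 0))"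
    by (rule computable_rec1) (intro computable_intros; simp)+
  moreover have "rec_nat b (\<lambda>_ r. r - 1) a = b - a" for a b :: nat
    by (induction a) auto
  ultimately show "computable 2 (\<lambda>xs. xs ! 1 - xs ! 0)"
    by simp
qed

lemma computable_if_eq [computable_intros]:
  assumes "computable n a" "computable n b" "computable n g" "computable n h"
  shows "computable n (\<lambda>xs. if a xs = b xs then g xs else h xs)"
proof -
  have "computable n (\<lambda>xs. if (a xs - b xs) + (b xs - a xs) = 0 then g xs else h xs)"
    by (intro computable_intros assms)
  moreover have "(x - y) + (y - x) = 0 \<longleftrightarrow> x = y" for x y :: nat by auto
  ultimately show ?thesis by simp
qed

lemma computable_mod2 [computable_intros]:
  assumes "computable n f"
  shows "computable n (\<lambda>xs. f xs mod 2)"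
proof (rule computable_comp2 [OF _ assms computable_const [of n 0]])
  have "computable 2 (\<lambda>xs. rec_nat 0 (\<lambda>_ r. 1 - r) (xs ! 0))"
    by (rule computable_rec1) (intro computable_intros; simp)+
  moreover have "rec_nat 0 (\<lambda>_ r. 1 - r) a = a mod 2" for a :: nat
    by (induction a) (auto simp: mod_Suc)
  ultimately show "computable 2 (\<lambda>xs. xs ! 0 mod 2)"
    by simp
qed

lemma computable_div2 [computable_intros]:
  assumes "computable n f"
  shows "computable n (\<lambda>xs. f xs div 2)"
proof (rule computable_comp2 [OF _ assms computable_const [of n 0]])
  \<comment> \<open>\<open>a div 2\<close> is the number of odd \<open>k\<close> below
    \<open>a\<close>.\<close>
  have "computable 2 (\<lambda>xs. rec_nat 0 (\<lambda>k r. r + k mod 2) (xs ! 0))"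
    by (rule computable_rec1) (intro computable_intros; simp)+
  moreover have "rec_nat 0 (\<lambda>k r. r + k mod 2) a = a div 2" for a :: nat
    by (induction a) (simp_all, presburger)
  ultimately show "computable 2 (\<lambda>xs. xs ! 0 div 2)"
    by simp
qed

section \<open>Triangular numbers and the pairing function\<close>

lemma computable_triangle [computable_intros]:
  assumes "computable n f"
  shows "computable n (\<lambda>xs. triangle (f xs))"
proof (rule computable_comp2 [OF _ assms computable_const [of n 0]])
  have "computable 2 (\<lambda>xs. rec_nat 0 (\<lambda>k r. r + Suc k) (xs ! 0))"
    by (rule computable_rec1) (intro computable_intros; simp)+
  moreover have "rec_nat 0 (\<lambda>k r. r + Suc k) a = triangle a" for a :: nat
    by (induction a) auto
  ultimately show "computable 2 (\<lambda>xs. triangle (xs ! 0))"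
    by simp
qed

lemma computable_prod_encode [computable_intros]:
  assumes "computable n f" "computable n g"
  shows "computable n (\<lambda>xs. prod_encode (f xs, g xs))"
  unfolding prod_encode_def prod.case by (intro computable_intros assms)

lemma triangle_mono: "i \<le> j \<Longrightarrow> triangle i \<le> triangle j"
  by (induction rule: dec_induct) auto

text \<open>The codes on the diagonal \<open>a + b = s\<close> fill the interval from
  \<open>triangle s\<close> up to, but excluding, \<open>triangle (Suc s)\<close>. The diagonal is
  thus the least \<open>s\<close> whose \<open>triangle (Suc s)\<close> exceeds the code, written as
  a vanishing truncated difference to fit minimization.\<close>

lemma triangle_root:
  "(LEAST s. Suc (prod_encode (a, b)) - triangle (Suc s) = 0) = a + b"
proof (rule Least_equality)
  fix s assume s: "Suc (prod_encode (a, b)) - triangle (Suc s) = 0"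
  show "a + b \<le> s"
  proof (rule ccontr)
    assume "\<not> a + b \<le> s"
    then have "triangle (Suc s) \<le> triangle (a + b)" by (intro triangle_mono) simp
    with s show False by (simp add: prod_encode_def)
  qed
qed (simp add: prod_encode_def)

lemma computable_prod_decode [computable_intros]:
  assumes "computable n f"
  shows "computable n (\<lambda>xs. fst (prod_decode (f xs)))" "computable n (\<lambda>xs. snd (prod_decode (f xs)))"
proof -
  define s where "s = (\<lambda>m. LEAST y. Suc m - triangle (Suc y) = 0)"
  have "\<exists>y. Suc m - triangle (Suc y) = 0" for m by (rule exI [of _ m]) simp
  then have "computable 1 (\<lambda>xs. s (xs ! 0))"
    unfolding s_def by (intro computable_least) (intro computable_intros; simp)+
  note s = computable_comp1 [OF this]
  have eq: "fst (prod_decode m) = m - triangle (s m)"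
    "snd (prod_decode m) = s m - (m - triangle (s m))" for m
  proof -
    obtain a b where m: "m = prod_encode (a, b)" by (metis prod_decode_inverse surj_pair)
    have "s m = a + b" unfolding s_def m by (rule triangle_root)
    then show "fst (prod_decode m) = m - triangle (s m)"
      "snd (prod_decode m) = s m - (m - triangle (s m))"
      by (simp_all add: m) (simp_all add: prod_encode_def)
  qed
  show "computable n (\<lambda>xs. fst (prod_decode (f xs)))" "computable n (\<lambda>xs. snd (prod_decode (f xs)))"
    unfolding eq by (intro computable_intros s assms)+
qed


section \<open>Iteration, folds over coded lists, bounded search\<close>

lemma computable_funpow:
  assumes "computable 1 (\<lambda>xs. F (xs ! 0))" "computable n a" "computable n b"
  shows "computable n (\<lambda>xs. (F ^^ a xs) (b xs))"
proof (rule computable_comp2 [OF _ assms(2,3)])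
  have "computable 2 (\<lambda>xs. rec_nat (xs ! 1) (\<lambda>_ r. F r) (xs ! 0))"
    by (rule computable_rec1) (intro computable_intros computable_comp1 [OF assms(1)]; simp)+
  moreover have "rec_nat b (\<lambda>_ r. F r) a = (F ^^ a) b" for a b
    by (induction a) auto
  ultimately show "computable 2 (\<lambda>xs. (F ^^ (xs ! 0)) (xs ! 1))"
    by simp
qed

lemma length_le_list_encode: "length xs \<le> list_encode xs"
  by (induction xs) (auto intro: order_trans [OF _ le_prod_encode_2])

text \<open>The fold becomes an iteration of \<open>G\<close> on pairs of remaining list and state.
  The code of the list serves as number of rounds: it is at least the length, and \<open>G\<close>
  is idle once the list is empty, so surplus rounds are harmless.\<close>

lemma computable_fold_code:
  assumes F: "computable 2 (\<lambda>xs. F (xs ! 0) (xs ! 1))" and "computable n a" "computable n b"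
  shows "computable n (\<lambda>xs. fold F (list_decode (a xs)) (b xs))"
proof (rule computable_comp2 [OF _ assms(2,3)])
  define G where "G p = (let l = fst (prod_decode p) in if l = 0 then p else
    prod_encode (snd (prod_decode (l - 1)), F (fst (prod_decode (l - 1))) (snd (prod_decode p))))" for p
  have "computable 1 (\<lambda>xs. G (xs ! 0))"
    unfolding G_def Let_def by (intro computable_intros computable_comp2 [OF F]) simp_all
  then have "computable 2 (\<lambda>xs. snd (prod_decode ((G ^^ (xs ! 0)) (prod_encode (xs ! 0, xs ! 1)))))"
    by (intro computable_intros computable_funpow) simp_all
  moreover have "snd (prod_decode ((G ^^ k) (prod_encode (list_encode l, s)))) = fold F l s"
    if "length l \<le> k" for k l s
    using that
  proof (induction k arbitrary: l s)
    case (Suc k)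
    then show ?case
    proof (cases l)
      case Nil
      then have "G (prod_encode (list_encode l, s)) = prod_encode (list_encode l, s)"
        by (simp add: G_def)
      then show ?thesis using Suc.IH [of l s] Nil by (simp add: funpow_swap1)
    next
      case (Cons x l')
      then have "G (prod_encode (list_encode l, s)) = prod_encode (list_encode l', F x s)"
        by (simp add: G_def)
      then show ?thesis using Suc Cons by (simp add: funpow_swap1)
    qed
  qed simp
  then have "snd (prod_decode ((G ^^ m) (prod_encode (m, s)))) = fold F (list_decode m) s" for m s
    using length_le_list_encode [of "list_decode m"] by (metis list_decode_inverse)
  ultimately show "computable 2 (\<lambda>xs. fold F (list_decode (xs ! 0)) (xs ! 1))" by simp
qed

lemma computable_foldr_code:
  assumes F: "computable 2 (\<lambda>xs. F (xs ! 0) (xs ! 1))" and ab: "computable n a" "computable n b"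
  shows "computable n (\<lambda>xs. foldr F (list_decode (a xs)) (b xs))"
proof -
  \<comment> \<open>Folding with Cons on codes reverses the list, and \<open>foldr\<close> is
    \<open>fold\<close> over the reversed list.\<close>
  have "computable n (\<lambda>xs. fold (\<lambda>x l. Suc (prod_encode (x, l))) (list_decode (a xs)) 0)"
    by (intro computable_fold_code computable_intros ab) simp_all
  moreover have "fold (\<lambda>x l. Suc (prod_encode (x, l))) l (list_encode l') = list_encode (rev l @ l')" for l l'
    by (induction l arbitrary: l') (simp_all flip: list_encode.simps)
  from this [of _ "[]"]
  have "fold (\<lambda>x l. Suc (prod_encode (x, l))) l 0 = list_encode (rev l)" for l by simp
  ultimately have "computable n (\<lambda>xs. list_encode (rev (list_decode (a xs))))" by simp
  from computable_fold_code [OF F this ab(2)] show ?thesis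
    by (simp add: foldr_conv_fold)
qed

lemma computable_bex:
  assumes F: "computable 3 (\<lambda>xs. if P (xs ! 0) (xs ! 1) (xs ! 2) then 1 else 0)"
    and abc: "computable n a" "computable n b" "computable n c"
  shows "computable n (\<lambda>xs. if \<exists>k<a xs. P k (b xs) (c xs) then 1 else 0)"
proof (rule computable_comp3 [OF _ abc])
  let ?p = "\<lambda>k x y. if P k x y then 1 else (0::nat)"
  have "computable 3 (\<lambda>xs. rec_nat 0 (\<lambda>k r. if ?p k (xs ! 1) (xs ! 2) = 0 then r else 1) (xs ! 0))"
    by (rule computable_rec2) (intro computable_intros computable_comp3 [OF F]; simp)+
  moreover have "rec_nat 0 (\<lambda>k r. if ?p k x y = 0 then r else 1) m = (if \<exists>k<m. P k x y then 1 else (0::nat))" for m x y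
    by (induction m) (auto simp: less_Suc_eq)
  ultimately show "computable 3 (\<lambda>xs. if \<exists>k<xs ! 0. P k (xs ! 1) (xs ! 2) then 1 else 0)"
    by simp
qed


section \<open>Conjugacy in free groups\<close>

lemma reduced_iff_successively: "reduced w \<longleftrightarrow> successively (\<lambda>a b. b \<noteq> inv_letter a) w"
  by (induction w rule: reduced.induct) auto

lemma reduced_append:
  "reduced (u @ v) \<longleftrightarrow> reduced u \<and> reduced v \<and> (u = [] \<or> v = [] \<or> hd v \<noteq> inv_letter (last u))"
  unfolding reduced_iff_successively by (rule successively_append_iff)

lemma inv_letter_neq [simp]: "inv_letter a \<noteq> a"
  by (cases a) auto

lemma inv_letter_eq_iff [simp]: "inv_letter a = inv_letter b \<longleftrightarrow> a = b"
  by (metis inv_letter_inv_letter)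

section \<open>Formal inverses and reduction of arbitrary words\<close>

definition inv_word :: "'a gword \<Rightarrow> 'a gword" where
  "inv_word w = rev (map inv_letter w)"

lemma inv_word_simps [simp]:
  "inv_word [] = []" "inv_word (a # w) = inv_word w @ [inv_letter a]"
  "inv_word (v @ w) = inv_word w @ inv_word v"
  "inv_word (inv_word w) = w" "length (inv_word w) = length w"
  "inv_word w = [] \<longleftrightarrow> w = []"
  by (simp_all add: inv_word_def rev_map o_def)

lemma hd_inv_word: "w \<noteq> [] \<Longrightarrow> hd (inv_word w) = inv_letter (last w)"
  and last_inv_word: "w \<noteq> [] \<Longrightarrow> last (inv_word w) = inv_letter (hd w)"
  by (simp_all add: inv_word_def hd_rev last_rev hd_map last_map)

lemma reduced_inv_word: "reduced (inv_word w) \<longleftrightarrow> reduced w"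
proof (induction w)
  case (Cons a w)
  then show ?case
    by (cases w) (auto simp: reduced_append last_inv_word)
qed simp

text \<open>Equations in the free group are stated as equal values of \<open>reduce\<close> on
  concatenations, so that factors can be inserted and cancelled on plain lists.\<close>

definition reduce :: "'a gword \<Rightarrow> 'a gword" where
  "reduce w = foldr letter_mult w []"

lemma reduced_reduce: "reduced (reduce w)"
  by (simp add: reduce_def reduced_foldr)

lemma reduce_reduced: "reduced w \<Longrightarrow> reduce w = w"
  by (simp add: reduce_def foldr_reduced)

lemma reduce_append: "reduce (u @ v) = foldr letter_mult u (reduce v)"
  by (simp add: reduce_def)

lemma reduce_append_mult: "reduce (u @ v) = reduce u \<otimes>\<^bsub>free_group\<^esub> reduce v"
  using foldr_assoc [of "reduce v" u "[]"]
  by (simp add: reduce_append free_group_def reduced_reduce) (simp add: reduce_def)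

lemma reduce_cong:
  assumes "reduce v = reduce w"
  shows "reduce (u @ v @ u') = reduce (u @ w @ u')"
  using assms by (simp add: reduce_append_mult)

lemma reduce_cancel [simp]: "reduce (u @ inv_word v @ v @ w) = reduce (u @ w)"
  "reduce (u @ v @ inv_word v @ w) = reduce (u @ w)"
  using foldr_inv_word [of "reduce w" v] foldr_inv_word [of "reduce w" "inv_word v"]
  by (simp_all add: reduce_append reduced_reduce inv_word_def [symmetric])


lemma reduce_cancel_end [simp]: "reduce (inv_word v @ v @ w) = reduce w"
  "reduce (v @ inv_word v @ w) = reduce w"
  "reduce (u @ inv_word v @ v) = reduce u" "reduce (u @ v @ inv_word v) = reduce u"
  using reduce_cancel [of "[]" v w] reduce_cancel [of u v "[]"] by simp_all

lemma reduce_left_cancel: "reduce (u @ v) = reduce (u @ w) \<longleftrightarrow> reduce v = reduce w"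
  using reduce_cong [of "u @ v" "u @ w" "inv_word u" "[]"] reduce_cong [of v w u "[]"] by auto

text \<open>Cyclic reducedness of \<open>C\<close> is expressed as \<open>reduced (C @ C)\<close>.\<close>

lemma reduced_square_swap:
  assumes "reduced ((u @ v) @ (u @ v))"
  shows "reduced ((v @ u) @ (v @ u))"
proof (cases "u = [] \<or> v = []")
  case True
  then show ?thesis using assms by auto
next
  \<comment> \<open>Both squares have the same junctions: \<open>u\<close> followed by
    \<open>v\<close>, and \<open>v\<close> followed by \<open>u\<close>.\<close>
  case False
  then show ?thesis using assms unfolding reduced_append by simp
qed

text \<open>Let \<open>a\<close> be the first letter of the conjugator. If \<open>C\<close> starts
  with \<open>a\<close> or ends with its inverse, conjugating by \<open>a\<close> merely rotates
  \<open>C\<close> by one place and leaves a shorter conjugator. Otherwise nothing cancels in g^-1 C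
  g, where g is the whole conjugator, so this word is \<open>D\<close>; but its first and last
  letters are mutually inverse, which contradicts cyclic reducedness of \<open>D\<close>.\<close>

lemma rotate_of_conjugate:
  assumes "reduced (C @ C)" "reduced (D @ D)" "reduced g" "reduce (C @ g) = reduce (g @ D)"
  shows "\<exists>n. D = rotate n C"
  using assms
proof (induction g arbitrary: C)
  case Nil
  then have "C = D" by (simp add: reduced_append reduce_reduced)
  then show ?case by (intro exI [of _ 0]) simp
next
  case (Cons a g)
  have g: "reduced g" using Cons.prems(3) by (rule reduced_tl)
  show ?case
  proof (cases "C = []")
    case True
    then have "reduce ((a # g) @ D) = reduce ((a # g) @ [])" using Cons.prems(4) by simp
    then have "D = []"
      using Cons.prems(2) unfolding reduce_left_cancel by (simp add: reduced_append reduce_reduced)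
    with True show ?thesis by simp
  next
    case nonempty: False
    show ?thesis
    proof (cases "hd C = a")
      case True
      then obtain E where C: "C = a # E" using nonempty by (cases C) auto
      have "reduce ([a] @ (E @ [a]) @ g) = reduce ([a] @ g @ D)"
        using Cons.prems(4) C by simp
      then have "reduce ((E @ [a]) @ g) = reduce (g @ D)" unfolding reduce_left_cancel .
      then obtain n where "D = rotate n (rotate1 C)"
        using Cons.IH [of "rotate1 C"] Cons.prems(1,2) g reduced_square_swap [of "[a]" E] C by auto
      then show ?thesis by (metis rotate1_rotate_swap rotate_Suc)
    next
      case hd: False
      show ?thesis
      proof (cases "last C = inv_letter a")
        case True
        then obtain E where C: "C = E @ [inv_letter a]" using nonempty by (metis append_butlast_last_id)
        define E' where "E' = inv_letter a # E"
        have "reduce ([a] @ E' @ g) = reduce (E @ g)"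
          using reduce_cancel_end(2) [of "[a]" "E @ g"] by (simp add: E'_def)
        also have "\<dots> = reduce (C @ a # g)"
          using reduce_cancel(1) [of E "[a]" g] by (simp add: C)
        also have "\<dots> = reduce ([a] @ g @ D)" using Cons.prems(4) by simp
        finally have *: "reduce (E' @ g) = reduce (g @ D)" unfolding reduce_left_cancel .
        have "reduced (E' @ E')"
          using Cons.prems(1) reduced_square_swap [of E "[inv_letter a]"] by (simp add: C E'_def)
        then obtain n where n: "D = rotate n E'" using Cons.IH [OF _ Cons.prems(2) g *] by blast
        have "E' = rotate (length E) C" by (simp add: C E'_def rotate_append)
        with n show ?thesis by (metis rotate_rotate)
      next
        case last: False
        let ?w = "inv_word (a # g) @ C @ a # g"
        have "reduced C" using Cons.prems(1) by (simp add: reduced_append)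
        then have "reduced (C @ a # g)"
          using Cons.prems(3) last unfolding reduced_append [of C] by (auto dest: sym)
        then have "reduced ?w"
          using Cons.prems(3) hd nonempty
          unfolding reduced_append [of "inv_word (a # g)"] reduced_inv_word
          by (simp add: last_inv_word del: inv_word_simps(2))
        have "reduce ((a # g) @ ?w) = reduce ((a # g) @ D)"
          using Cons.prems(4) reduce_cancel_end(2) [of "a # g" "C @ a # g"]
          by (simp del: inv_word_simps)
        then have "reduce ?w = reduce D" unfolding reduce_left_cancel .
        then have "?w = D"
          using \<open>reduced ?w\<close> Cons.prems(2) by (simp add: reduced_append reduce_reduced)
        moreover have "hd ?w = inv_letter (last ?w)"
          using hd_inv_word [of "a # g"] by (simp add: hd_append del: inv_word_simps(2))
        moreover have "?w \<noteq> []" by simp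
        ultimately show ?thesis using Cons.prems(2) by (auto simp: reduced_append)
      qed
    qed
  qed
qed

text \<open>A reduced word fails to be cyclically reduced only if its first and last letters are
  mutually inverse; these are stripped and collected in \<open>P\<close>.\<close>

lemma cyclic_reduction:
  assumes "reduced U"
  obtains P C where "U = P @ C @ inv_word P" "reduced (C @ C)"
  using assms
proof (induction "length U" arbitrary: U thesis rule: less_induct)
  case less
  show ?case
  proof (cases "reduced (U @ U)")
    case True
    then show ?thesis using less.prems(1) [of "[]" U] by simp
  next
    case False
    then have U: "U \<noteq> []" "hd U = inv_letter (last U)"
      using less.prems(2) by (auto simp: reduced_append)
    then obtain a V where V: "U = a # V" by (cases U) auto
    \<comment> \<open>A single letter would have to be its own inverse.\<close>
    with U have "V \<noteq> []" by (cases V) (auto dest: sym)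
    then obtain M where "V = M @ [inv_letter a]" using U V by (metis append_butlast_last_id inv_letter_inv_letter last_ConsR list.sel(1))
    then have M: "U = [a] @ M @ inv_word [a]" using V by simp
    have "reduced M" using less.prems(2) unfolding M by (simp only: reduced_append)
    then obtain P C where "M = P @ C @ inv_word P" "reduced (C @ C)"
      using less.hyps [of M] M by auto
    then show ?thesis using less.prems(1) [of "a # P" C] M by simp
  qed
qed

text \<open>Conjugating the cyclically reduced cores turns \<open>g\<close> into P^-1 g Q, so
  \<open>D\<close> is a rotation of \<open>C\<close>. A rotation is conjugation by a prefix of
  \<open>C\<close>, hence P (prefix) Q^-1 conjugates \<open>U\<close> to \<open>V\<close>, and its
  length is at most |P| + |C| + |Q|.\<close>

lemma conjugator_bound:
  assumes "reduced U" "reduced V" and g: "reduce (U @ g) = reduce (g @ V)"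
  obtains h where "length h \<le> length U + length V" "reduce (U @ h) = reduce (h @ V)"
proof -
  obtain P C where U: "U = P @ C @ inv_word P" "reduced (C @ C)"
    using assms(1) by (rule cyclic_reduction)
  obtain Q D where V: "V = Q @ D @ inv_word Q" "reduced (D @ D)"
    using assms(2) by (rule cyclic_reduction)
  define k where "k = reduce (inv_word P @ g @ Q)"
  have "reduce (C @ k) = reduce (C @ inv_word P @ g @ Q)"
    using reduce_cong [of k "inv_word P @ g @ Q" C "[]"]
    by (simp add: k_def reduced_reduce reduce_reduced)
  also have "\<dots> = reduce (inv_word P @ (U @ g) @ Q)" by (simp add: U)
  also have "\<dots> = reduce (inv_word P @ (g @ V) @ Q)" using g by (rule reduce_cong)
  also have "\<dots> = reduce ((inv_word P @ g @ Q) @ D)"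
    using reduce_cancel_end(3) [of "inv_word P @ g @ Q @ D" Q] by (simp add: V)
  also have "\<dots> = reduce (k @ D)"
    using reduce_cong [of k "inv_word P @ g @ Q" "[]" D]
    by (simp add: k_def reduced_reduce reduce_reduced)
  finally obtain n where n: "D = rotate n C"
    using rotate_of_conjugate [OF U(2) V(2)] reduced_reduce k_def by metis
  \<comment> \<open>Reducing the rotation modulo the length makes it a split of \<open>C\<close>.
    For empty \<open>C\<close> the value is \<open>n\<close>, and the prefix is still empty.\<close>
  define i where "i = n mod length C"
  let ?h = "P @ take i C @ inv_word Q"
  have "reduce (U @ ?h) = reduce (P @ C @ take i C @ inv_word Q)"
    using reduce_cancel(1) [of "P @ C" P "take i C @ inv_word Q"] by (simp add: U)
  also have "\<dots> = reduce (P @ take i C @ D @ inv_word Q)"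
    by (simp add: n rotate_drop_take i_def) (metis append_assoc append_take_drop_id)
  also have "\<dots> = reduce (?h @ V)"
    using reduce_cancel(1) [of "P @ take i C" Q "D @ inv_word Q"] by (simp add: V)
  finally show ?thesis by (intro that [of ?h]) (simp_all add: U V)
qed


section \<open>The isomorphism with the free group of rank two\<close>

abbreviation F2 :: "bool gword monoid" where "F2 \<equiv> free_group"

text \<open>\<open>False\<close> names t and \<open>True\<close> names x_0, which gives t, t^-1,
  x_0, x_0^-1 the letter codes 0, 1, 2, 3 under \<open>of_bool\<close>.\<close>

abbreviation T2 :: "bool gword" where "T2 \<equiv> [(False, True)]"

abbreviation X2 :: "bool gword" where "X2 \<equiv> [(True, True)]"

definition x_in_F2 :: "int \<Rightarrow> bool gword" where
  "x_in_F2 i = T2 [^]\<^bsub>F2\<^esub> i \<otimes>\<^bsub>F2\<^esub> X2 \<otimes>\<^bsub>F2\<^esub> T2 [^]\<^bsub>F2\<^esub> (- i)"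

definition to_F2 :: "int \<times> int gword \<Rightarrow> bool gword" where
  "to_F2 = (\<lambda>(m, V). T2 [^]\<^bsub>F2\<^esub> m \<otimes>\<^bsub>F2\<^esub> word_value F2 x_in_F2 V)"

definition of_F2 :: "bool gword \<Rightarrow> int \<times> int gword" where
  "of_F2 = word_value F_inf_ext (\<lambda>b. if b then gen_value (Gen_x 0) else gen_value Gen_t)"

interpretation F2: group F2 by (rule group_free_group)
interpretation Fi: group F_inf by (simp add: F_inf_def group_free_group)
interpretation FE: group F_inf_ext by (rule group_F_inf_ext)

lemma generator_closed [simp]: "[a] \<in> carrier free_group"
  by (simp add: free_group_def)

lemma x_in_F2_closed [simp]: "x_in_F2 i \<in> carrier F2"
  by (simp add: x_in_F2_def)

text \<open>The images in rank two satisfy the defining relation of the extension, for all powers of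
  t at once.\<close>

lemma x_in_F2_diff: "x_in_F2 (i - n) = T2 [^]\<^bsub>F2\<^esub> (- n) \<otimes>\<^bsub>F2\<^esub> x_in_F2 i \<otimes>\<^bsub>F2\<^esub> T2 [^]\<^bsub>F2\<^esub> n"
proof -
  have "T2 [^]\<^bsub>F2\<^esub> (i - n) = T2 [^]\<^bsub>F2\<^esub> (- n) \<otimes>\<^bsub>F2\<^esub> T2 [^]\<^bsub>F2\<^esub> i"
    "T2 [^]\<^bsub>F2\<^esub> (- (i - n)) = T2 [^]\<^bsub>F2\<^esub> (- i) \<otimes>\<^bsub>F2\<^esub> T2 [^]\<^bsub>F2\<^esub> n"
    by (simp_all add: F2.int_pow_mult [symmetric])
  then show ?thesis by (simp add: x_in_F2_def F2.m_assoc)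
qed

section \<open>Integer powers of the shift and products in the extension\<close>

lemma reduced_shifted: "reduced (map (\<lambda>(i, e). (i - n :: int, e)) w) \<longleftrightarrow> reduced w"
  by (induction w rule: reduced.induct) auto

text \<open>The product of the extension uses an abstract power in the automorphism group; this
  makes it explicit. Both induction steps rest on phi^(n+1) = phi^n o phi, the downward one applied
  to the preimage of \<open>V\<close> under the shift.\<close>

lemma shift_int_pow:
  "shift [^]\<^bsub>AutoGroup F_inf\<^esub> n = restrict (map (\<lambda>(i, e). (i - n, e))) (carrier F_inf)"
proof -
  interpret A: group "AutoGroup F_inf" by (rule Fi.AutoGroup)
  have sA: "shift \<in> carrier (AutoGroup F_inf)" using shift_auto by (simp add: AutoGroup_def)
  let ?s = "\<lambda>n::int. restrict (map (\<lambda>(i::int, e::bool). (i - n, e))) (carrier F_inf)"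
  have auto: "shift [^]\<^bsub>AutoGroup F_inf\<^esub> n \<in> auto F_inf" for n :: int
    using A.int_pow_closed [OF sA, of n] by (simp add: AutoGroup_def)
  have add: "(shift [^]\<^bsub>AutoGroup F_inf\<^esub> (n + 1)) V
      = (shift [^]\<^bsub>AutoGroup F_inf\<^esub> n) (shift V)" if "V \<in> carrier F_inf" for V and n :: int
  proof -
    have "shift [^]\<^bsub>AutoGroup F_inf\<^esub> (n + 1)
        = shift [^]\<^bsub>AutoGroup F_inf\<^esub> n \<otimes>\<^bsub>AutoGroup F_inf\<^esub> shift"
      using A.int_pow_mult [OF sA, of n 1] sA by simp
    then show ?thesis
      using auto [of n] shift_auto that
      by (simp add: AutoGroup_def BijGroup_def auto_def compose_def)
  qed
  have "(shift [^]\<^bsub>AutoGroup F_inf\<^esub> n) V = map (\<lambda>(i, e). (i - n, e)) V" if "reduced V" for V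
    using that
  proof (induction n arbitrary: V rule: int_induct [where k = 0])
    case base
    then show ?case
      by (simp add: AutoGroup_def BijGroup_def F_inf_def free_group_def split_def)
  next
    case (step1 n)
    have "shift V = map (\<lambda>(i, e). (i - 1, e)) V"
      using step1.prems by (simp add: shift_def F_inf_def free_group_def)
    then show ?case
      using step1.IH [of "shift V"] add [of V n] step1.prems reduced_shifted [of 1 V]
      by (simp add: F_inf_def free_group_def split_def o_def algebra_simps)
  next
    case (step2 n)
    let ?V = "map (\<lambda>(i, e). (i + 1, e)) V"
    have r: "reduced ?V" using reduced_shifted [of "-1" V] step2.prems by simp
    then have "shift ?V = V"
      by (simp add: shift_def F_inf_def free_group_def split_def o_def)
    then show ?case
      using step2.IH [of ?V] add [of ?V "n - 1"] r
      by (simp add: F_inf_def free_group_def split_def o_def algebra_simps)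
  qed
  moreover have "shift [^]\<^bsub>AutoGroup F_inf\<^esub> n \<in> extensional (carrier F_inf)"
    using auto [of n] by (simp add: auto_def Bij_def)
  ultimately show ?thesis
    by (intro extensionalityI [of _ "carrier F_inf"]) (auto simp: F_inf_def free_group_def)
qed

lemma F_inf_ext_simps:
  "carrier F_inf_ext = UNIV \<times> carrier F_inf"
  "V \<in> carrier F_inf \<Longrightarrow> (m, V) \<otimes>\<^bsub>F_inf_ext\<^esub> (n, W) =
    (m + n, map (\<lambda>(i, e). (i - n, e)) V \<otimes>\<^bsub>F_inf\<^esub> W)"
  by (simp_all add: F_inf_ext_def cyclic_extension_def shift_int_pow)

section \<open>Word values under homomorphisms\<close>

lemma word_value_Cons: "word_value G f (a # w) = letter_value G f a \<otimes>\<^bsub>G\<^esub> word_value G f w"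
  by (simp add: word_value_def)

lemma letter_value_closed:
  "group G \<Longrightarrow> (\<And>x. f x \<in> carrier G) \<Longrightarrow> letter_value G f a \<in> carrier G"
  by (auto simp: letter_value_def group.inv_closed split: prod.split)

lemma word_value_closed:
  assumes "group G" "\<And>x. f x \<in> carrier G"
  shows "word_value G f w \<in> carrier G"
proof -
  interpret group G by fact
  show ?thesis
    by (induction w) (simp add: word_value_def, simp add: word_value_Cons letter_value_closed assms)
qed

lemma hom_word_value:
  assumes "group G" "group H" "h \<in> hom G H" "\<And>x. f x \<in> carrier G"
  shows "h (word_value G f w) = word_value H (h \<circ> f) w"
proof -
  interpret group_hom G H h
    using assms by (simp add: group_hom_def group_hom_axioms_def)
  have "h (letter_value G f a) = letter_value H (h \<circ> f) a" for a
    using assms(4) by (cases a) (simp add: letter_value_def)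
  then show ?thesis
    by (induction w)
      (simp_all add: word_value_Cons letter_value_closed word_value_closed assms(1,4),
        simp add: word_value_def)
qed

text \<open>Conjugation by a power of t is an endomorphism of \<open>F2\<close> that sends the image
  of x_i to that of x_(i-n), and endomorphisms pass through word values.\<close>

lemma word_value_shifted:
  "word_value F2 x_in_F2 (map (\<lambda>(i, e). (i - n, e)) V) =
    T2 [^]\<^bsub>F2\<^esub> (- n) \<otimes>\<^bsub>F2\<^esub> word_value F2 x_in_F2 V \<otimes>\<^bsub>F2\<^esub> T2 [^]\<^bsub>F2\<^esub> n"
proof -
  let ?c = "\<lambda>g. T2 [^]\<^bsub>F2\<^esub> (- n) \<otimes>\<^bsub>F2\<^esub> g \<otimes>\<^bsub>F2\<^esub> T2 [^]\<^bsub>F2\<^esub> n"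
  have "?c g \<otimes>\<^bsub>F2\<^esub> ?c h = ?c (g \<otimes>\<^bsub>F2\<^esub> h)" if "g \<in> carrier F2" "h \<in> carrier F2" for g h
  proof -
    have "?c g \<otimes>\<^bsub>F2\<^esub> ?c h
        = T2 [^]\<^bsub>F2\<^esub> (- n) \<otimes>\<^bsub>F2\<^esub> g \<otimes>\<^bsub>F2\<^esub> (T2 [^]\<^bsub>F2\<^esub> n \<otimes>\<^bsub>F2\<^esub> T2 [^]\<^bsub>F2\<^esub> (- n)) \<otimes>\<^bsub>F2\<^esub> h \<otimes>\<^bsub>F2\<^esub> T2 [^]\<^bsub>F2\<^esub> n"
      using that by (simp add: F2.m_assoc)
    then show ?thesis
      using that by (simp add: F2.int_pow_mult [symmetric] F2.m_assoc)
  qed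
  then have "?c \<in> hom F2 F2" by (intro homI) auto
  from hom_word_value [OF F2.is_group F2.is_group this, of x_in_F2 V]
  have "?c (word_value F2 x_in_F2 V) = word_value F2 (\<lambda>i. x_in_F2 (i - n)) V"
    by (simp add: x_in_F2_diff o_def)
  also have "\<dots> = word_value F2 x_in_F2 (map (\<lambda>(i, e). (i - n, e)) V)"
    by (induction V) (auto simp: word_value_Cons letter_value_def word_value_def)
  finally show ?thesis by simp
qed

text \<open>With v, w the values of \<open>V\<close>, \<open>W\<close>: t^m v t^n w = t^(m+n) (t^-n
  v t^n) w, and the bracket is the value of the shifted \<open>V\<close>.\<close>

lemma to_F2_hom: "to_F2 \<in> hom F_inf_ext F2"
proof (rule homI)
  fix a assume "a \<in> carrier F_inf_ext"
  show "to_F2 a \<in> carrier F2"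
    by (cases a) (simp add: to_F2_def word_value_closed)
next
  fix a b assume ab: "a \<in> carrier F_inf_ext" "b \<in> carrier F_inf_ext"
  obtain m V n W where eq: "a = (m, V)" "b = (n, W)" by (cases a; cases b)
  have VW: "V \<in> carrier F_inf" "W \<in> carrier F_inf" using ab by (auto simp: eq F_inf_ext_simps)
  let ?w = "word_value F2 x_in_F2" and ?t = "\<lambda>k::int. T2 [^]\<^bsub>F2\<^esub> k"
  have w: "?w V \<in> carrier F2" for V by (simp add: word_value_closed)
  have "map (\<lambda>(i, e). (i - n, e)) V \<in> carrier F_inf"
    using VW(1) reduced_shifted [of n V] by (simp add: F_inf_def free_group_def)
  then have "to_F2 (a \<otimes>\<^bsub>F_inf_ext\<^esub> b) = ?t (m + n) \<otimes>\<^bsub>F2\<^esub> (?w (map (\<lambda>(i, e). (i - n, e)) V) \<otimes>\<^bsub>F2\<^esub> ?w W)"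
    using VW word_value_hom(1) [OF F2.is_group, of x_in_F2]
    by (simp add: eq F_inf_ext_simps to_F2_def) (simp add: F_inf_def hom_mult)
  also have "\<dots> = ?t m \<otimes>\<^bsub>F2\<^esub> (?t n \<otimes>\<^bsub>F2\<^esub> ?t (- n)) \<otimes>\<^bsub>F2\<^esub> ?w V \<otimes>\<^bsub>F2\<^esub> ?t n \<otimes>\<^bsub>F2\<^esub> ?w W"
    unfolding word_value_shifted by (simp add: F2.int_pow_mult [of _ m n] F2.m_assoc w)
  also have "\<dots> = to_F2 a \<otimes>\<^bsub>F2\<^esub> to_F2 b"
    by (simp add: F2.int_pow_mult [symmetric] to_F2_def eq F2.m_assoc w)
  finally show "to_F2 (a \<otimes>\<^bsub>F_inf_ext\<^esub> b) = to_F2 a \<otimes>\<^bsub>F2\<^esub> to_F2 b" .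
qed

lemma of_F2_hom: "of_F2 \<in> hom F2 F_inf_ext"
  unfolding of_F2_def by (rule word_value_hom(1) [OF FE.is_group]) (simp add: gen_value_carrier del: gen_value.simps)

lemma to_F2_gen_value:
  "to_F2 (gen_value Gen_t) = T2" "to_F2 (gen_value (Gen_x i)) = x_in_F2 i"
  by (simp_all add: to_F2_def word_value_def letter_value_def)

lemma gen_t_int_pow: "gen_value Gen_t [^]\<^bsub>F_inf_ext\<^esub> (n::int) = (n, [])"
proof -
  have [simp]: "[] \<in> carrier F_inf" "[] \<otimes>\<^bsub>F_inf\<^esub> [] = []"
    by (simp_all add: F_inf_def free_group_def)
  have one: "\<one>\<^bsub>F_inf_ext\<^esub> = (0, [])"
    by (simp add: F_inf_ext_def cyclic_extension_def F_inf_def free_group_def)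
  have nat: "gen_value Gen_t [^]\<^bsub>F_inf_ext\<^esub> (k::nat) = (int k, [])" for k
    by (induction k) (simp_all add: one F_inf_ext_simps)
  have "inv\<^bsub>F_inf_ext\<^esub> (k, []) = (- k, [])" for k
    by (rule FE.inv_equality) (simp_all add: one F_inf_ext_simps)
  then show ?thesis
    by (simp add: int_pow_def2 nat del: gen_value.simps)
qed

text \<open>This is how injectivity of \<open>to_F2\<close> enters: a word value is recovered from
  its image, so conjugators found in \<open>F2\<close> can be carried back.\<close>

lemma of_F2_to_F2_gen_value: "of_F2 (to_F2 (gen_value g)) = gen_value g"
proof -
  interpret H: group_hom F2 F_inf_ext of_F2
    by (simp add: group_hom_def group_hom_axioms_def FE.is_group F2.is_group of_F2_hom)
  have T: "of_F2 T2 = gen_value Gen_t" and X: "of_F2 X2 = gen_value (Gen_x 0)"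
    unfolding of_F2_def
    by (simp_all add: word_value_hom(2) [OF FE.is_group] gen_value_carrier del: gen_value.simps)
  have "of_F2 (x_in_F2 i) = gen_value (Gen_x i)" for i
    by (simp add: x_in_F2_def H.hom_int_pow T X gen_t_int_pow del: gen_value.simps)
      (simp add: F_inf_ext_simps F_inf_def free_group_def)
  then show ?thesis by (cases g) (simp_all only: to_F2_gen_value T)
qed

section \<open>Transport of conjugacy to rank two\<close>

definition value_in_F2 :: "gen gword \<Rightarrow> bool gword" where
  "value_in_F2 = word_value F2 (to_F2 \<circ> gen_value)"

lemma to_F2_word_value: "to_F2 (word_value F_inf_ext gen_value w) = value_in_F2 w"
  unfolding value_in_F2_def
  by (rule hom_word_value [OF FE.is_group F2.is_group to_F2_hom gen_value_carrier])

lemma to_F2_gen_closed: "to_F2 (gen_value g) \<in> carrier F2"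
  using to_F2_hom gen_value_carrier by (auto simp: hom_def)

lemma of_F2_value_in_F2: "of_F2 (value_in_F2 w) = word_value F_inf_ext gen_value w"
  unfolding value_in_F2_def
  using hom_word_value [OF F2.is_group FE.is_group of_F2_hom, of "to_F2 \<circ> gen_value" w]
  by (simp add: to_F2_gen_closed of_F2_to_F2_gen_value o_def)

lemma value_in_F2_closed: "value_in_F2 w \<in> carrier F2"
  unfolding value_in_F2_def by (rule word_value_closed) (simp_all add: to_F2_gen_closed)

lemma conjugate_in_hom:
  assumes "group G" "group H" "h \<in> hom G H" "a \<in> carrier G" "conjugate_in G a b"
  shows "conjugate_in H (h a) (h b)"
proof -
  interpret group_hom G H h using assms by (simp add: group_hom_def group_hom_axioms_def)
  show ?thesis using assms(4,5) unfolding conjugate_in_def by fastforce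
qed

text \<open>Homomorphisms preserve conjugacy: \<open>to_F2\<close> gives one direction,
  \<open>of_F2\<close> the other.\<close>

lemma conjugate_in_F2_iff:
  "conjugate_in F_inf_ext (word_value F_inf_ext gen_value u) (word_value F_inf_ext gen_value v)
    \<longleftrightarrow> conjugate_in F2 (value_in_F2 u) (value_in_F2 v)"
proof
  assume "conjugate_in F_inf_ext (word_value F_inf_ext gen_value u) (word_value F_inf_ext gen_value v)"
  from conjugate_in_hom [OF FE.is_group F2.is_group to_F2_hom _ this]
  show "conjugate_in F2 (value_in_F2 u) (value_in_F2 v)"
    by (simp add: to_F2_word_value word_value_closed gen_value_carrier)
next
  assume "conjugate_in F2 (value_in_F2 u) (value_in_F2 v)"
  from conjugate_in_hom [OF F2.is_group FE.is_group of_F2_hom _ this]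
  show "conjugate_in F_inf_ext (word_value F_inf_ext gen_value u) (word_value F_inf_ext gen_value v)"
    by (simp add: of_F2_value_in_F2 value_in_F2_closed)
qed


section \<open>The decision procedure\<close>

definition code_F2 :: "bool gword \<Rightarrow> nat" where
  "code_F2 = word_code of_bool"

lemma code_F2_simps [simp]:
  "code_F2 [] = 0" "code_F2 (a # w) = Suc (prod_encode (letter_code of_bool a, code_F2 w))"
  by (simp_all add: code_F2_def word_code_def)

lemma letter_code_simps:
  "letter_code c (x, e) = 2 * c x + (if e then 0 else 1)"
  by (simp add: letter_code_def sum_encode_def)

lemma letter_code_of_bool_eq_iff [simp]:
  "letter_code of_bool a = letter_code of_bool b \<longleftrightarrow> a = b"
  by (cases a; cases b) (auto simp: letter_code_simps of_bool_def split: if_splits)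

lemma code_F2_eq_iff [simp]: "code_F2 v = code_F2 w \<longleftrightarrow> v = w"
proof (induction v arbitrary: w)
  case Nil
  then show ?case by (cases w) auto
next
  case (Cons a v)
  then show ?case by (cases w) auto
qed

text \<open>A generator numbered \<open>k\<close> has letter code \<open>2 * k\<close> and its
  inverse \<open>2 * k + 1\<close>.\<close>

definition inv_letter_on_codes :: "nat \<Rightarrow> nat" where
  "inv_letter_on_codes c = (if c mod 2 = 0 then Suc c else c - 1)"

definition letter_mult_on_codes :: "nat \<Rightarrow> nat \<Rightarrow> nat" where
  "letter_mult_on_codes c n = (if n = 0 then Suc (prod_encode (c, 0))
    else if fst (prod_decode (n - 1)) = inv_letter_on_codes c then snd (prod_decode (n - 1))
    else Suc (prod_encode (c, n)))"

lemma computable_letter_mult_on_codes [computable_intros]: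
  assumes "computable n f" "computable n g"
  shows "computable n (\<lambda>xs. letter_mult_on_codes (f xs) (g xs))"
  unfolding letter_mult_on_codes_def inv_letter_on_codes_def by (intro computable_intros assms)

lemma inv_letter_on_codes:
  "inv_letter_on_codes (letter_code of_bool a) = letter_code of_bool (inv_letter a)"
  by (cases a) (auto simp: inv_letter_on_codes_def letter_code_simps)

lemma letter_mult_on_codes:
  "letter_mult_on_codes (letter_code of_bool a) (code_F2 w) = code_F2 (letter_mult a w)"
  by (cases w) (auto simp: letter_mult_on_codes_def inv_letter_on_codes)

text \<open>
  On codes, \<open>t\<close>, its inverse, \<open>x\<^sub>0\<close> and its inverse are the letters 0, 1, 2, 3, both in
  \<open>gen gword\<close> and in \<open>bool gword\<close>.
\<close>

definition gen_letter_mult_on_codes :: "nat \<Rightarrow> nat \<Rightarrow> nat" where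
  "gen_letter_mult_on_codes c s =
    (if c div 2 = 0 then letter_mult_on_codes c s
     else if (c div 2 - 1) mod 2 = 0
     then (letter_mult_on_codes 0 ^^ ((c div 2 - 1) div 2)) (letter_mult_on_codes (2 + c mod 2)
       ((letter_mult_on_codes 1 ^^ ((c div 2 - 1) div 2)) s))
     else (letter_mult_on_codes 1 ^^ Suc ((c div 2 - 1) div 2)) (letter_mult_on_codes (2 + c mod 2)
       ((letter_mult_on_codes 0 ^^ Suc ((c div 2 - 1) div 2)) s)))"

lemma computable_gen_letter_mult_on_codes:
  "computable 2 (\<lambda>xs. gen_letter_mult_on_codes (xs ! 0) (xs ! 1))"
  unfolding gen_letter_mult_on_codes_def
  by (intro computable_intros computable_funpow [of "letter_mult_on_codes 0"]
    computable_funpow [of "letter_mult_on_codes 1"]) simp_all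

section \<open>Left multiplication by generators and their powers\<close>

lemma free_group_mult_Cons:
  "(a # u) \<otimes>\<^bsub>free_group\<^esub> v = letter_mult a (u \<otimes>\<^bsub>free_group\<^esub> v)"
  by (simp add: free_group_def)

lemma free_group_mult_Nil: "[] \<otimes>\<^bsub>free_group\<^esub> v = v"
  by (simp add: free_group_def)

lemma inv_generator: "inv\<^bsub>free_group\<^esub> [a] = [inv_letter a]"
proof -
  interpret group free_group by (rule group_free_group)
  show ?thesis
    by (rule inv_equality) (simp_all add: generator_closed, simp add: free_group_def)
qed

lemma funpow_letter_mult_on_codes:
  "(letter_mult_on_codes (letter_code of_bool a) ^^ k) (code_F2 s) = code_F2 ((letter_mult a ^^ k) s)"
  by (induction k) (simp_all add: letter_mult_on_codes)

lemma generator_pow_mult: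
  assumes "s \<in> carrier free_group"
  shows "[a] [^]\<^bsub>free_group\<^esub> (k::nat) \<otimes>\<^bsub>free_group\<^esub> s = (letter_mult a ^^ k) s"
proof -
  interpret group free_group by (rule group_free_group)
  show ?thesis using assms
  proof (induction k)
    case (Suc k)
    have "[a] [^]\<^bsub>free_group\<^esub> Suc k \<otimes>\<^bsub>free_group\<^esub> s
        = [a] \<otimes>\<^bsub>free_group\<^esub> ([a] [^]\<^bsub>free_group\<^esub> k \<otimes>\<^bsub>free_group\<^esub> s)"
      using Suc.prems unfolding nat_pow_Suc2 [OF generator_closed] by (simp add: m_assoc)
    with Suc show ?case
      by (simp add: free_group_mult_Cons free_group_mult_Nil)
  qed simp
qed

lemma T2_int_pow:
  "T2 [^]\<^bsub>F2\<^esub> (int k) = T2 [^]\<^bsub>F2\<^esub> k" "T2 [^]\<^bsub>F2\<^esub> (- int k) = [(False, False)] [^]\<^bsub>F2\<^esub> k"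
  by (simp_all add: int_pow_int F2.int_pow_neg_int F2.nat_pow_inv [symmetric] inv_generator)

text \<open>Inverting a conjugate inverts only its middle factor, so both exponents of x_i share one
  recipe.\<close>

lemma letter_value_Gen_x:
  "letter_value F2 (to_F2 \<circ> gen_value) (Gen_x i, e) =
    T2 [^]\<^bsub>F2\<^esub> i \<otimes>\<^bsub>F2\<^esub> [(True, e)] \<otimes>\<^bsub>F2\<^esub> T2 [^]\<^bsub>F2\<^esub> (- i)"
  by (simp add: letter_value_def to_F2_gen_value x_in_F2_def F2.inv_mult_group F2.int_pow_neg
      inv_generator F2.m_assoc del: gen_value.simps)

lemma letter_value_Gen_t:
  "letter_value F2 (to_F2 \<circ> gen_value) (Gen_t, e) = [(False, e)]"
  by (simp add: letter_value_def to_F2_gen_value inv_generator del: gen_value.simps)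

text \<open>Half the letter code is 0 for t and \<open>Suc (int_encode i)\<close> for x_i. As
  \<open>int_encode i\<close> is 2i for i \<ge> 0 and 2(-i-1) + 1 for i < 0, its parity gives the
  sign of i and its half gives |i|, short by one in the negative case; hence the \<open>Suc\<close>
  on the exponents there. The parity of the letter code itself selects x_0 or its inverse.\<close>

lemma gen_letter_mult_on_codes:
  assumes "s \<in> carrier F2"
  shows "gen_letter_mult_on_codes (letter_code gen_code a) (code_F2 s) =
    code_F2 (letter_value F2 (to_F2 \<circ> gen_value) a \<otimes>\<^bsub>F2\<^esub> s)"
proof -
  obtain g e where a: "a = (g, e)" by (cases a)
  let ?L = letter_mult_on_codes and ?x = "letter_code of_bool (True, e)"
  have codes: "?L 0 = ?L (letter_code of_bool (False, True))" "?L 1 = ?L (letter_code of_bool (False, False))"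
    by (simp_all add: letter_code_simps)
  have closed: "T2 [^]\<^bsub>F2\<^esub> (k::int) \<otimes>\<^bsub>F2\<^esub> s \<in> carrier F2" for k
    using assms by simp
  have mult: "T2 [^]\<^bsub>F2\<^esub> i \<otimes>\<^bsub>F2\<^esub> [(True, e)] \<otimes>\<^bsub>F2\<^esub> T2 [^]\<^bsub>F2\<^esub> (- i) \<otimes>\<^bsub>F2\<^esub> s =
      T2 [^]\<^bsub>F2\<^esub> i \<otimes>\<^bsub>F2\<^esub> letter_mult (True, e) (T2 [^]\<^bsub>F2\<^esub> (- i) \<otimes>\<^bsub>F2\<^esub> s)" for i :: int
    using assms
    by (simp add: F2.m_assoc) (simp add: free_group_mult_Cons free_group_mult_Nil)
  have red: "letter_mult (True, e) (T2 [^]\<^bsub>F2\<^esub> k \<otimes>\<^bsub>F2\<^esub> s) \<in> carrier F2" for k :: int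
    using closed [of k] by (simp add: free_group_def reduced_letter_mult)
  show ?thesis
  proof (cases g)
    case Gen_t
    have "letter_code gen_code a = letter_code of_bool (False, e)"
      by (simp add: a Gen_t letter_code_simps)
    then show ?thesis
      by (simp add: a Gen_t gen_letter_mult_on_codes_def letter_value_Gen_t letter_mult_on_codes
          free_group_mult_Cons free_group_mult_Nil) (simp add: letter_code_simps)
  next
    case (Gen_x i)
    have c: "letter_code gen_code a div 2 = Suc (int_encode i)"
      "2 + letter_code gen_code a mod 2 = ?x"
      by (simp_all add: a Gen_x letter_code_simps)
    show ?thesis
    proof (cases "i \<ge> 0")
      case True
      then obtain k where i: "i = int k" by (metis nonneg_int_cases)
      then have "int_encode i = 2 * k" by (simp add: int_encode_def sum_encode_def)
      with c have "gen_letter_mult_on_codes (letter_code gen_code a) (code_F2 s) =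
          (?L 0 ^^ k) (?L ?x ((?L 1 ^^ k) (code_F2 s)))"
        by (simp add: gen_letter_mult_on_codes_def)
      also have "\<dots> = code_F2 (T2 [^]\<^bsub>F2\<^esub> i \<otimes>\<^bsub>F2\<^esub> letter_mult (True, e) (T2 [^]\<^bsub>F2\<^esub> (- i) \<otimes>\<^bsub>F2\<^esub> s))"
        using red [of "- i"] unfolding codes i T2_int_pow
        by (simp add: generator_pow_mult funpow_letter_mult_on_codes letter_mult_on_codes assms)
      finally show ?thesis
        unfolding a Gen_x letter_value_Gen_x mult .
    next
      case False
      define k where "k = nat (- i)"
      have i: "i = - int k" "- i = int k" using False by (simp_all add: k_def)
      have "int_encode i = Suc (2 * (k - 1))"
        using False by (simp add: int_encode_def sum_encode_def k_def nat_diff_distrib)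
      moreover have "Suc (k - 1) = k" using False by (simp add: k_def)
      ultimately have "gen_letter_mult_on_codes (letter_code gen_code a) (code_F2 s) =
          (?L 1 ^^ k) (?L ?x ((?L 0 ^^ k) (code_F2 s)))"
        using c by (simp add: gen_letter_mult_on_codes_def del: funpow.simps)
      also have "\<dots> = code_F2 (T2 [^]\<^bsub>F2\<^esub> i \<otimes>\<^bsub>F2\<^esub> letter_mult (True, e) (T2 [^]\<^bsub>F2\<^esub> (- i) \<otimes>\<^bsub>F2\<^esub> s))"
        using red [of "- i"] unfolding codes i(2) unfolding i(1) T2_int_pow
        by (simp add: generator_pow_mult funpow_letter_mult_on_codes letter_mult_on_codes assms)
      finally show ?thesis
        unfolding a Gen_x letter_value_Gen_x mult .
    qed
  qed
qed

text \<open>The arguments are of different kinds: \<open>m\<close> codes any word in t and the x_i,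
  \<open>s\<close> a reduced word over \<open>bool\<close>. With \<open>s = 0\<close>, the empty
  word, this evaluates \<open>m\<close> in rank two.\<close>

definition mult_on_codes :: "nat \<Rightarrow> nat \<Rightarrow> nat" where
  "mult_on_codes m s = foldr gen_letter_mult_on_codes (list_decode m) s"

lemma computable_mult_on_codes [computable_intros]:
  assumes "computable n f" "computable n g"
  shows "computable n (\<lambda>xs. mult_on_codes (f xs) (g xs))"
  unfolding mult_on_codes_def
  by (rule computable_foldr_code [OF computable_gen_letter_mult_on_codes assms])

lemma mult_on_codes:
  assumes "s \<in> carrier F2"
  shows "mult_on_codes (word_code gen_code u) (code_F2 s) = code_F2 (value_in_F2 u \<otimes>\<^bsub>F2\<^esub> s)"
proof (induction u)
  case Nil
  show ?case
    using assms by (simp add: mult_on_codes_def word_code_def value_in_F2_def word_value_def)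
next
  case (Cons a u)
  have "letter_value F2 (to_F2 \<circ> gen_value) a \<in> carrier F2"
    by (rule letter_value_closed) (simp_all add: to_F2_gen_closed)
  with Cons assms show ?case
    by (simp add: mult_on_codes_def word_code_def value_in_F2_def word_value_Cons)
      (simp add: gen_letter_mult_on_codes value_in_F2_closed F2.m_assoc flip: value_in_F2_def)
qed

lemma mult_on_codes_zero: "mult_on_codes (word_code gen_code u) 0 = code_F2 (value_in_F2 u)"
  using mult_on_codes [of "[]" u] value_in_F2_closed [of u] F2.r_one
  by (simp add: free_group_def foldr_reduced)

text \<open>Reading \<open>False\<close> as t and \<open>True\<close> as x_0 leaves the code
  unchanged, so the code of a conjugator in \<open>F2\<close> is a legitimate first argument of
  \<open>mult_on_codes\<close>.\<close>

lemma code_F2_eq_word_code: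
  obtains u where "word_code gen_code u = code_F2 g" "value_in_F2 u = reduce g"
proof
  let ?u = "map (\<lambda>(b, e). (if b then Gen_x 0 else Gen_t, e)) g"
  show "word_code gen_code ?u = code_F2 g"
    unfolding word_code_def code_F2_def map_map
    by (intro arg_cong [where f = list_encode] map_cong)
      (auto simp: letter_code_simps int_encode_def sum_encode_def)
  have "letter_value F2 (to_F2 \<circ> gen_value) (if b then Gen_x 0 else Gen_t, e) = [(b, e)]" for b e
    by (simp add: letter_value_Gen_x letter_value_Gen_t del: o_apply)
  then show "value_in_F2 ?u = reduce g"
    by (induction g) (auto simp: value_in_F2_def word_value_Cons reduce_def free_group_mult_Cons
      free_group_mult_Nil, simp_all add: word_value_def free_group_def)
qed

section \<open>The bound on the search\<close>

lemma prod_encode_mono: "a \<le> c \<Longrightarrow> b \<le> d \<Longrightarrow> prod_encode (a, b) \<le> prod_encode (c, d)"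
  by (auto simp: prod_encode_def intro!: add_mono triangle_mono)

text \<open>The code of x_0^-1 repeated \<open>n\<close> times. Since 3 is the largest letter code
  and pairing is monotone, no word of at most \<open>n\<close> letters has a larger code.\<close>

definition code_bound :: "nat \<Rightarrow> nat" where
  "code_bound n = ((\<lambda>k. Suc (prod_encode (3, k))) ^^ n) 0"

lemma computable_code_bound [computable_intros]:
  assumes "computable n f"
  shows "computable n (\<lambda>xs. code_bound (f xs))"
  unfolding code_bound_def
  by (intro computable_funpow assms computable_intros) simp_all

lemma code_F2_le: "length w \<le> n \<Longrightarrow> code_F2 w \<le> code_bound n"
proof (induction n arbitrary: w)
  case (Suc n)
  show ?case
  proof (cases w)
    case (Cons a v)
    have "letter_code of_bool a \<le> 3"
      by (cases a) (auto simp: letter_code_simps)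
    then show ?thesis
      using Suc Cons by (simp add: code_bound_def prod_encode_mono)
  qed simp
qed (simp add: code_bound_def)

lemma length_le_code_F2: "length w \<le> code_F2 w"
  using length_le_list_encode [of "map (letter_code of_bool) w"]
  by (simp add: code_F2_def word_code_def)

text \<open>A form free of inverses, which two left multiplications on each side can test.\<close>

lemma conjugate_in_iff_commute:
  assumes "group G" "a \<in> carrier G" "b \<in> carrier G"
  shows "conjugate_in G a b \<longleftrightarrow> (\<exists>g\<in>carrier G. a \<otimes>\<^bsub>G\<^esub> g = g \<otimes>\<^bsub>G\<^esub> b)"
proof -
  interpret group G by fact
  show ?thesis
    unfolding conjugate_in_def using assms(2,3) by (metis inv_solve_left m_assoc inv_closed m_closed)
qed

text \<open>A conjugator may be replaced by the short one of \<open>conjugator_bound\<close>, whose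
  code lies below the bound. Conversely every \<open>k\<close> codes some word, and the value of
  that word conjugates.\<close>

lemma conjugate_iff_bounded_search:
  "conjugate_in F2 (value_in_F2 u) (value_in_F2 v) \<longleftrightarrow>
    (\<exists>k < Suc (code_bound (mult_on_codes (word_code gen_code u) 0 + mult_on_codes (word_code gen_code v) 0)).
      mult_on_codes (word_code gen_code u) (mult_on_codes k 0) =
      mult_on_codes k (mult_on_codes (word_code gen_code v) 0))"
    (is "?conj \<longleftrightarrow> (\<exists>k < ?b. ?P k)")
proof
  have P: "?P (word_code gen_code g) \<longleftrightarrow>
      value_in_F2 u \<otimes>\<^bsub>F2\<^esub> value_in_F2 g = value_in_F2 g \<otimes>\<^bsub>F2\<^esub> value_in_F2 v" for g
    by (simp add: mult_on_codes_zero mult_on_codes value_in_F2_closed)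
  {
    assume ?conj
    then obtain g where g: "g \<in> carrier F2" "value_in_F2 u \<otimes>\<^bsub>F2\<^esub> g = g \<otimes>\<^bsub>F2\<^esub> value_in_F2 v"
      by (auto simp: conjugate_in_iff_commute F2.is_group value_in_F2_closed)
    have red: "reduced (value_in_F2 u)" "reduced (value_in_F2 v)" "reduced g"
      using value_in_F2_closed g(1) by (simp_all add: free_group_def)
    with g(2) have "reduce (value_in_F2 u @ g) = reduce (g @ value_in_F2 v)"
      by (simp add: reduce_append_mult reduce_reduced)
    with red obtain h where h: "length h \<le> length (value_in_F2 u) + length (value_in_F2 v)"
      "reduce (value_in_F2 u @ h) = reduce (h @ value_in_F2 v)"
      by (metis conjugator_bound)
    obtain w where w: "word_code gen_code w = code_F2 h" "value_in_F2 w = reduce h"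
      by (rule code_F2_eq_word_code)
    have "?P (code_F2 h)"
      unfolding w(1) [symmetric] P w(2) using h(2) red by (simp add: reduce_append_mult reduce_reduced)
    moreover have "code_F2 h < ?b"
      \<comment> \<open>The bound is computed from codes in place of lengths; a code is at least the
        length of its word.\<close>
      using h(1) length_le_code_F2 [of "value_in_F2 u"] length_le_code_F2 [of "value_in_F2 v"]
      by (auto simp: mult_on_codes_zero less_Suc_eq_le intro!: code_F2_le)
    ultimately show "\<exists>k < ?b. ?P k" by blast
  next
    assume "\<exists>k < ?b. ?P k"
    then obtain w where "?P (word_code gen_code w)"
      using bij_word_code [OF bij_gen_code] by (metis bij_pointE)
    then show ?conj
      unfolding P
      by (auto simp: conjugate_in_iff_commute F2.is_group value_in_F2_closed)
  }
qed

theorem theorem5p1: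
  shows "conjugacy_problem_solvable F_inf_ext gen_value gen_code"
proof -
  let ?R = "\<lambda>m n. \<exists>k < Suc (code_bound (mult_on_codes m 0 + mult_on_codes n 0)).
    mult_on_codes m (mult_on_codes k 0) = mult_on_codes k (mult_on_codes n 0)"
  have "computable 2 (\<lambda>xs. if ?R (xs ! 0) (xs ! 1) then 1 else 0)"
    by (intro computable_bex [where P = "\<lambda>k m n. mult_on_codes m (mult_on_codes k 0) = mult_on_codes k (mult_on_codes n 0)"]
      computable_intros) simp_all
  then have "decidable_rel ?R"
    unfolding computable_def decidable_rel_def by force
  moreover have "?R = (\<lambda>m n. \<exists>u v. word_code gen_code u = m \<and> word_code gen_code v = n \<and>
      conjugate_in F_inf_ext (word_value F_inf_ext gen_value u) (word_value F_inf_ext gen_value v))"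
  proof (intro ext iffI)
    fix m n
    assume R: "?R m n"
    \<comment> \<open>\<open>?R\<close> speaks of numbers alone; as every number codes a word, it
      agrees with the conjugacy relation everywhere.\<close>
    obtain u v where "m = word_code gen_code u" "n = word_code gen_code v"
      using bij_word_code [OF bij_gen_code] by (metis bij_pointE)
    with R show "\<exists>u v. word_code gen_code u = m \<and> word_code gen_code v = n \<and>
        conjugate_in F_inf_ext (word_value F_inf_ext gen_value u) (word_value F_inf_ext gen_value v)"
      unfolding conjugate_in_F2_iff conjugate_iff_bounded_search by blast
  next
    fix m n
    assume "\<exists>u v. word_code gen_code u = m \<and> word_code gen_code v = n \<and>
      conjugate_in F_inf_ext (word_value F_inf_ext gen_value u) (word_value F_inf_ext gen_value v)"
    then show "?R m n"
      unfolding conjugate_in_F2_iff conjugate_iff_bounded_search by blast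
  qed
  ultimately show ?thesis
    unfolding conjugacy_problem_solvable_def by simp
qed

end
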